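(* Let $\Omega\subseteq\mathbb{H}$ be a symmetric slice domain, and let $f:\Omega\to\mathbb{H}$ be a regular function. Then $f$ admits a twistor lift to $\mathcal{O}=\pi^{-1}(\Omega\setminus\mathbb{R})\cap\mathcal{Q}^+$; in other words, there exists a holomorphic mapping $F:\mathcal{O}\to\mathbb{CP}^3$ of the form $$F[1,u,v,uv]=\big[1,\ u,\ g(v)-u\,\hat h(v),\ h(v)+u\,\hat g(v)\big]$$ (at $u=\infty$: $F[0,1,0,v]=[0,1,-\hat h(v),\hat g(v)]$), where $g,h:\Omega\cap\mathbb{C}\to\mathbb{C}$ are holomorphic functions and $\hat g(z)=\overline{g(\bar z)}$, $\hat h(z)=\overline{h(\bar z)}$, such that $\pi\circ F=f\circ\pi$.
   Context: $\mathbb{H}$ denotes the quaternions, $\mathbb{S}=\{q\in\mathbb{H}:q^2=-1\}$, $L_I=\mathbb{R}+I\mathbb{R}$ for $I\in\mathbb{S}$, and $\mathbb{C}$ is identified with $L_i\subset\mathbb{H}$; $\mathbb{C}^+$ is the open upper half-plane. A symmetric slice domain is a domain $\Omega\subseteq\mathbb{H}$ such that $\Omega\cap\mathbb{R}\ne\emptyset$, $\Omega_I=\Omega\cap L_I$ is open and connected in $L_I$ for every $I\in\mathbb{S}$, and $\Omega$ is axially symmetric with respect to $\mathbb{R}$ (i.e. $x+yI\in\Omega$ for some $I\in\mathbb{S}$ implies $x+yI'\in\Omega$ for all $I'\in\mathbb{S}$). A function $f:\Omega\to\mathbb{H}$ is (slice) regular if for all $I\in\mathbb{S}$ the restriction $f_I=f|_{\Omega_I}$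 satisfies $\frac12\left(\frac{\partial}{\partial x}+I\frac{\partial}{\partial y}\right)f_I(x+Iy)=0$ on $\Omega_I$. $\mathbb{HP}^1$ is the set of classes $[q_1,q_2]$ with $[q_1,q_2]=[pq_1,pq_2]$ for all $p\in\mathbb{H}\setminus\{0\}$; $\mathbb{H}$ is embedded in $\mathbb{HP}^1$ by $q\mapsto[1,q]$. The twistor projection is $\pi:\mathbb{CP}^3\to\mathbb{HP}^1$, $\pi[Z_0,Z_1,Z_2,Z_3]=[Z_0+Z_1j,\ Z_2+Z_3j]$. $\mathcal{Q}=\{[Z_0,Z_1,Z_2,Z_3]\in\mathbb{CP}^3:Z_0Z_3=Z_1Z_2\}$, and $\mathcal{Q}^+$ is the open subset of $\mathcal{Q}$ of points satisfying $Z_0\neq0$ and $Z_2/Z_0\in\mathbb{C}^+$, or $Z_1\ne0$ and $Z_3/Z_1\in\mathbb{C}^+$. Points of $\mathcal{Q}^+$ are written $[1,u,v,uv]$ with $v\in\mathbb{C}^+$, $u\in\mathbb{C}\cup\{\infty\}$, the value $u=\infty$ corresponding to $[0,1,0,v]$; $\pi$ maps $\mathcal{Q}^+$ bijectively onto $\mathbb{H}\setminus\mathbb{R}$. *)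

theory Defs
  imports "HOL-Analysis.Analysis"
begin

section \<open>Quaternions\<close>

datatype quat = Quat (qre: real) (qi: real) (qj: real) (qk: real)

lemma quat_eq_iff: "p = q \<longleftrightarrow> qre p = qre q \<and> qi p = qi q \<and> qj p = qj q \<and> qk p = qk q"
  by (cases p; cases q) auto

instantiation quat :: ring_1
begin

definition "0 = Quat 0 0 0 0"
definition "1 = Quat 1 0 0 0"
definition "p + q = Quat (qre p + qre q) (qi p + qi q) (qj p + qj q) (qk p + qk q)"
definition "p - q = Quat (qre p - qre q) (qi p - qi q) (qj p - qj q) (qk p - qk q)"
definition "- q = Quat (- qre q) (- qi q) (- qj q) (- qk q)"
definition "p * q = Quat
  (qre p * qre q - qi p * qi q - qj p * qj q - qk p * qk q)
  (qre p * qi q + qi p * qre q + qj p * qk q - qk p * qj q)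
  (qre p * qj q - qi p * qk q + qj p * qre q + qk p * qi q)
  (qre p * qk q + qi p * qj q - qj p * qi q + qk p * qre q)"

instance
  by standard
    (simp_all add: quat_eq_iff zero_quat_def one_quat_def plus_quat_def minus_quat_def
      uminus_quat_def times_quat_def algebra_simps)

end

lemma quat_sel_simps [simp]:
  "qre 0 = 0" "qi 0 = 0" "qj 0 = 0" "qk 0 = 0"
  "qre 1 = 1" "qi 1 = 0" "qj 1 = 0" "qk 1 = 0"
  "qre (p + q) = qre p + qre q" "qi (p + q) = qi p + qi q"
  "qj (p + q) = qj p + qj q" "qk (p + q) = qk p + qk q"
  "qre (p - q) = qre p - qre q" "qi (p - q) = qi p - qi q"
  "qj (p - q) = qj p - qj q" "qk (p - q) = qk p - qk q"
  "qre (- q) = - qre q" "qi (- q) = - qi q" "qj (- q) = - qj q" "qk (- q) = - qk q"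
  "qre (p * q) = qre p * qre q - qi p * qi q - qj p * qj q - qk p * qk q"
  "qi (p * q) = qre p * qi q + qi p * qre q + qj p * qk q - qk p * qj q"
  "qj (p * q) = qre p * qj q - qi p * qk q + qj p * qre q + qk p * qi q"
  "qk (p * q) = qre p * qk q + qi p * qj q - qj p * qi q + qk p * qre q"
  by (simp_all add: zero_quat_def one_quat_def plus_quat_def minus_quat_def
      uminus_quat_def times_quat_def)

instantiation quat :: real_vector
begin

definition "r *\<^sub>R q = Quat (r * qre q) (r * qi q) (r * qj q) (r * qk q)"

instance
  by standard (simp_all add: quat_eq_iff scaleR_quat_def algebra_simps)

end

instantiation quat :: real_inner
begin

definition "inner p q = qre p * qre q + qi p * qi q + qj p * qj q + qk p * qk q" for p q :: quat
definition "norm q = sqrt ((qre q)\<^sup>2 + (qi q)\<^sup>2 + (qj q)\<^sup>2 + (qk q)\<^sup>2)"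
definition "sgn q = q /\<^sub>R norm q" for q :: quat
definition "dist p q = norm (p - q)" for p q :: quat
definition "(uniformity :: (quat \<times> quat) filter)
  = (INF e\<in>{0<..}. principal {(p, q). dist p q < e})"
definition "open U \<longleftrightarrow> (\<forall>p\<in>U. eventually (\<lambda>(p', q). p' = p \<longrightarrow> q \<in> U) uniformity)"
  for U :: "quat set"

instance
proof
  fix p :: quat
  have "qre p * qre p + qi p * qi p + qj p * qj p + qk p * qk p = 0
    \<longleftrightarrow> qre p = 0 \<and> qi p = 0 \<and> qj p = 0 \<and> qk p = 0"
    by (smt (verit) mult_eq_0_iff zero_le_square)
  then show "inner p p = 0 \<longleftrightarrow> p = 0"
    by (simp add: inner_quat_def quat_eq_iff)
qed (auto simp: quat_eq_iff scaleR_quat_def inner_quat_def norm_quat_def sgn_quat_def dist_quat_def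
      uniformity_quat_def open_quat_def algebra_simps power2_eq_square)

end

lemma quat_sel_scaleR [simp]:
  "qre (r *\<^sub>R q) = r * qre q" "qi (r *\<^sub>R q) = r * qi q"
  "qj (r *\<^sub>R q) = r * qj q" "qk (r *\<^sub>R q) = r * qk q"
  by (simp_all add: scaleR_quat_def)

instantiation quat :: real_normed_div_algebra
begin

definition "inverse q = Quat (qre q) (- qi q) (- qj q) (- qk q) /\<^sub>R (norm q)\<^sup>2"
definition "p div q = p * inverse q" for p q :: quat

lemma norm_quat_sq: "(norm q)\<^sup>2 = (qre q)\<^sup>2 + (qi q)\<^sup>2 + (qj q)\<^sup>2 + (qk q)\<^sup>2" for q :: quat
  by (simp add: norm_quat_def)

instance
proof
  fix p q :: quat and r :: real
  show "r *\<^sub>R p * q = r *\<^sub>R (p * q)" "p * r *\<^sub>R q = r *\<^sub>R (p * q)"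
    by (simp_all add: quat_eq_iff algebra_simps)
  show "p div q = p * inverse q"
    by (simp add: divide_quat_def)
  show "inverse (0::quat) = 0"
    by (simp add: inverse_quat_def)
  have conj: "Quat (qre p) (- qi p) (- qj p) (- qk p) * p = (norm p)\<^sup>2 *\<^sub>R 1"
    "p * Quat (qre p) (- qi p) (- qj p) (- qk p) = (norm p)\<^sup>2 *\<^sub>R 1"
    unfolding norm_quat_sq by (simp_all add: quat_eq_iff power2_eq_square)
  have left: "(r *\<^sub>R a) * b = r *\<^sub>R (a * b)" and right: "a * (r *\<^sub>R b) = r *\<^sub>R (a * b)"
    for r and a b :: quat
    by (simp_all add: quat_eq_iff algebra_simps)
  show "inverse p * p = 1" "p * inverse p = 1" if "p \<noteq> 0"
    using that by (simp_all add: inverse_quat_def left right conj)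
  have "(norm (p * q))\<^sup>2 = (norm p * norm q)\<^sup>2"
    unfolding power_mult_distrib norm_quat_sq by (simp add: power2_eq_square algebra_simps)
  then show "norm (p * q) = norm p * norm q"
    by (simp add: power2_eq_iff_nonneg)
qed

end

text \<open>The identification of \<open>\<complex>\<close> with the slice \<open>\<real> + i\<real>\<close>.\<close>

definition quat_of_complex :: "complex \<Rightarrow> quat" where
  "quat_of_complex z = Quat (Re z) (Im z) 0 0"

definition quat_j :: quat where
  "quat_j = Quat 0 0 1 0"

lemma quat_of_complex_sel [simp]:
  "qre (quat_of_complex z) = Re z" "qi (quat_of_complex z) = Im z"
  "qj (quat_of_complex z) = 0" "qk (quat_of_complex z) = 0"
  by (simp_all add: quat_of_complex_def)

lemma quat_j_sel [simp]: "qre quat_j = 0" "qi quat_j = 0" "qj quat_j = 1" "qk quat_j = 0"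
  by (simp_all add: quat_j_def)

section \<open>Slice regular functions\<close>

definition imag_units :: "quat set" where
  "imag_units = {q. q\<^sup>2 = -1}"

definition slice :: "quat \<Rightarrow> quat set" where
  "slice I = {of_real x + of_real y * I | x y. True}"

definition symmetric_slice_domain :: "quat set \<Rightarrow> bool" where
  "symmetric_slice_domain \<Omega> \<longleftrightarrow>
     open \<Omega> \<and> connected \<Omega> \<and> \<Omega> \<inter> \<real> \<noteq> {} \<and>
     (\<forall>I\<in>imag_units. openin (top_of_set (slice I)) (\<Omega> \<inter> slice I) \<and> connected (\<Omega> \<inter> slice I)) \<and>
     (\<forall>x y. \<forall>I\<in>imag_units. \<forall>J\<in>imag_units.
        of_real x + of_real y * I \<in> \<Omega> \<longrightarrow> of_real x + of_real y * J \<in> \<Omega>)"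

text \<open>\<open>D (1, 0)\<close> and \<open>D (0, 1)\<close> are the partial derivatives of \<open>f\<^sub>I(x + yI)\<close> with respect to
  \<open>x\<close> and \<open>y\<close>. As usual for this notion, each restriction \<open>f\<^sub>I\<close> is real differentiable; the mere
  existence of partial derivatives satisfying the equation would not make it holomorphic
  (consider \<open>exp (- q\<^sup>-\<^sup>4)\<close>, extended by \<open>0\<close> at the origin).\<close>

definition slice_regular_on :: "(quat \<Rightarrow> quat) \<Rightarrow> quat set \<Rightarrow> bool" where
  "slice_regular_on f \<Omega> \<longleftrightarrow>
     (\<forall>I\<in>imag_units. \<forall>x y. of_real x + of_real y * I \<in> \<Omega> \<longrightarrow>
        (\<exists>D. ((\<lambda>(s, t). f (of_real s + of_real t * I)) has_derivative D) (at (x, y)) \<and>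
             (1/2) *\<^sub>R (D (1, 0) + I * D (0, 1)) = 0))"

section \<open>Projective spaces and the twistor projection\<close>

type_synonym complex4 = "complex \<times> complex \<times> complex \<times> complex"

fun scale4 :: "complex \<Rightarrow> complex4 \<Rightarrow> complex4" where
  "scale4 c (Z0, Z1, Z2, Z3) = (c * Z0, c * Z1, c * Z2, c * Z3)"

definition cp3_rel :: "complex4 \<Rightarrow> complex4 \<Rightarrow> bool" where
  "cp3_rel Z W \<longleftrightarrow> Z \<noteq> 0 \<and> (\<exists>c. c \<noteq> 0 \<and> W = scale4 c Z)"

lemma cp3_rel_part_equivp: "part_equivp cp3_rel"
proof (rule part_equivpI)
  show "\<exists>Z. cp3_rel Z Z"
    by (rule exI[of _ "(1, 0, 0, 0)"], unfold cp3_rel_def)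
      (auto simp: zero_prod_def intro!: exI[of _ 1])
  show "symp cp3_rel"
  proof (rule sympI)
    fix Z W assume "cp3_rel Z W"
    then obtain c where c: "c \<noteq> 0" "W = scale4 c Z" "Z \<noteq> 0"
      by (auto simp: cp3_rel_def)
    have "Z = scale4 (1 / c) W" "W \<noteq> 0"
      using c by (cases Z; simp add: zero_prod_def)+
    then show "cp3_rel W Z"
      using c(1) unfolding cp3_rel_def by (intro conjI exI[of _ "1 / c"]) simp_all
  qed
  show "transp cp3_rel"
  proof (rule transpI)
    fix X Y Z assume "cp3_rel X Y" "cp3_rel Y Z"
    then obtain c d where cd: "c \<noteq> 0" "Y = scale4 c X" "d \<noteq> 0" "Z = scale4 d Y" "X \<noteq> 0"
      by (auto simp: cp3_rel_def)
    have "Z = scale4 (d * c) X"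
      using cd by (cases X) simp
    then show "cp3_rel X Z"
      using cd unfolding cp3_rel_def by (intro conjI exI[of _ "d * c"]) simp_all
  qed
qed

quotient_type cp3 = complex4 / partial: cp3_rel
  by (rule cp3_rel_part_equivp)

text \<open>Homogeneous coordinates; meaningful only if the coordinates are not all zero.\<close>

definition cp3 :: "complex \<Rightarrow> complex \<Rightarrow> complex \<Rightarrow> complex \<Rightarrow> cp3" where
  "cp3 Z0 Z1 Z2 Z3 = abs_cp3 (Z0, Z1, Z2, Z3)"

definition hp1_rel :: "quat \<times> quat \<Rightarrow> quat \<times> quat \<Rightarrow> bool" where
  "hp1_rel v w \<longleftrightarrow> v \<noteq> 0 \<and> (\<exists>p. p \<noteq> 0 \<and> w = (p * fst v, p * snd v))"

lemma hp1_rel_part_equivp: "part_equivp hp1_rel"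
proof (rule part_equivpI)
  show "\<exists>v. hp1_rel v v"
    by (rule exI[of _ "(1, 0)"], unfold hp1_rel_def)
      (auto simp: zero_prod_def intro!: exI[of _ 1])
  show "symp hp1_rel"
  proof (rule sympI)
    fix v w assume "hp1_rel v w"
    then obtain p where p: "p \<noteq> 0" "w = (p * fst v, p * snd v)" "v \<noteq> 0"
      by (auto simp: hp1_rel_def)
    have "v = (inverse p * fst w, inverse p * snd w)" "w \<noteq> 0"
      using p by (cases v; simp add: zero_prod_def mult.assoc[symmetric])+
    then show "hp1_rel w v"
      using p(1) unfolding hp1_rel_def by (intro conjI exI[of _ "inverse p"]) simp_all
  qed
  show "transp hp1_rel"
  proof (rule transpI)
    fix u v w assume "hp1_rel u v" "hp1_rel v w"
    then obtain p q where pq: "p \<noteq> 0" "v = (p * fst u, p * snd u)"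
      "q \<noteq> 0" "w = (q * fst v, q * snd v)" "u \<noteq> 0"
      by (auto simp: hp1_rel_def)
    have "w = ((q * p) * fst u, (q * p) * snd u)"
      using pq by (simp add: mult.assoc)
    then show "hp1_rel u w"
      using pq unfolding hp1_rel_def by (intro conjI exI[of _ "q * p"]) simp_all
  qed
qed

quotient_type hp1 = "quat \<times> quat" / partial: hp1_rel
  by (rule hp1_rel_part_equivp)

definition hp1 :: "quat \<Rightarrow> quat \<Rightarrow> hp1" where
  "hp1 q1 q2 = abs_hp1 (q1, q2)"

definition hp1_embed :: "quat \<Rightarrow> hp1" where
  "hp1_embed q = hp1 1 q"

lemma inj_hp1_embed: "inj hp1_embed"
proof (rule injI)
  fix p q assume "hp1_embed p = hp1_embed q"
  moreover have "hp1_rel (1, x) (1, x)" for x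
    by (auto simp: hp1_rel_def zero_prod_def intro!: exI[of _ 1])
  ultimately have "hp1_rel (1, p) (1, q)"
    unfolding hp1_embed_def hp1_def using Quotient3_rel[OF Quotient3_hp1] by blast
  then show "p = q"
    by (auto simp: hp1_rel_def)
qed

lemma quat_of_complex_mult: "quat_of_complex (z * w) = quat_of_complex z * quat_of_complex w"
  by (simp add: quat_eq_iff)

lemma quat_of_complex_eq_0: "quat_of_complex z = 0 \<longleftrightarrow> z = 0"
  by (simp add: quat_eq_iff complex_eq_iff)

lemma quat_of_complex_pair_eq_0:
  "quat_of_complex z + quat_of_complex w * quat_j = 0 \<longleftrightarrow> z = 0 \<and> w = 0"
  by (auto simp: quat_eq_iff complex_eq_iff)

lift_definition twistor_proj :: "cp3 \<Rightarrow> hp1" is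
  "\<lambda>(Z0, Z1, Z2, Z3). (quat_of_complex Z0 + quat_of_complex Z1 * quat_j,
                     quat_of_complex Z2 + quat_of_complex Z3 * quat_j)"
  unfolding cp3_rel_def hp1_rel_def
  by (auto simp: zero_prod_def quat_of_complex_pair_eq_0 quat_of_complex_mult quat_of_complex_eq_0
      distrib_left mult.assoc intro!: exI[of _ "quat_of_complex _"])

section \<open>The quadric and holomorphic maps\<close>

lift_definition on_quadric :: "cp3 \<Rightarrow> bool" is "\<lambda>(Z0, Z1, Z2, Z3). Z0 * Z3 = Z1 * Z2"
  by (auto simp: cp3_rel_def)

lift_definition in_upper_part :: "cp3 \<Rightarrow> bool" is
  "\<lambda>(Z0, Z1, Z2, Z3). (Z0 \<noteq> 0 \<and> Im (Z2 / Z0) > 0) \<or> (Z1 \<noteq> 0 \<and> Im (Z3 / Z1) > 0)"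
  by (auto simp: cp3_rel_def)

definition quadric :: "cp3 set" where
  "quadric = {p. on_quadric p}"

definition quadric_plus :: "cp3 set" where
  "quadric_plus = {p \<in> quadric. in_upper_part p}"

lift_definition cp3_nz0 :: "cp3 \<Rightarrow> bool" is "\<lambda>(Z0, Z1, Z2, Z3). Z0 \<noteq> 0"
  by (auto simp: cp3_rel_def)
lift_definition cp3_nz1 :: "cp3 \<Rightarrow> bool" is "\<lambda>(Z0, Z1, Z2, Z3). Z1 \<noteq> 0"
  by (auto simp: cp3_rel_def)
lift_definition cp3_nz2 :: "cp3 \<Rightarrow> bool" is "\<lambda>(Z0, Z1, Z2, Z3). Z2 \<noteq> 0"
  by (auto simp: cp3_rel_def)
lift_definition cp3_nz3 :: "cp3 \<Rightarrow> bool" is "\<lambda>(Z0, Z1, Z2, Z3). Z3 \<noteq> 0"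
  by (auto simp: cp3_rel_def)

lift_definition cp3_aff0 :: "cp3 \<Rightarrow> complex^3" is
  "\<lambda>(Z0, Z1, Z2, Z3). vector [Z1 / Z0, Z2 / Z0, Z3 / Z0]"
  by (auto simp: cp3_rel_def)
lift_definition cp3_aff1 :: "cp3 \<Rightarrow> complex^3" is
  "\<lambda>(Z0, Z1, Z2, Z3). vector [Z0 / Z1, Z2 / Z1, Z3 / Z1]"
  by (auto simp: cp3_rel_def)
lift_definition cp3_aff2 :: "cp3 \<Rightarrow> complex^3" is
  "\<lambda>(Z0, Z1, Z2, Z3). vector [Z0 / Z2, Z1 / Z2, Z3 / Z2]"
  by (auto simp: cp3_rel_def)
lift_definition cp3_aff3 :: "cp3 \<Rightarrow> complex^3" is
  "\<lambda>(Z0, Z1, Z2, Z3). vector [Z0 / Z3, Z1 / Z3, Z2 / Z3]"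
  by (auto simp: cp3_rel_def)

definition cp3_atlas :: "(cp3 set \<times> (cp3 \<Rightarrow> complex^3)) set" where
  "cp3_atlas = {(Collect cp3_nz0, cp3_aff0), (Collect cp3_nz1, cp3_aff1),
                (Collect cp3_nz2, cp3_aff2), (Collect cp3_nz3, cp3_aff3)}"

text \<open>In each affine chart of \<open>\<complex>\<P>\<^sup>3\<close> the quadric is the graph of the remaining affine coordinate as
  the product of the two coordinates kept here: for \<open>Z\<^sub>0 \<noteq> 0\<close>, for instance,
  \<open>Z\<^sub>3/Z\<^sub>0 = (Z\<^sub>1/Z\<^sub>0) (Z\<^sub>2/Z\<^sub>0)\<close>. So each of these is a bijection onto \<open>\<complex>\<^sup>2\<close>, and together they
  give the complex structure of the quadric as a submanifold.\<close>

lift_definition quadric_aff0 :: "cp3 \<Rightarrow> complex^2" is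
  "\<lambda>(Z0, Z1, Z2, Z3). vector [Z1 / Z0, Z2 / Z0]"
  by (auto simp: cp3_rel_def)
lift_definition quadric_aff1 :: "cp3 \<Rightarrow> complex^2" is
  "\<lambda>(Z0, Z1, Z2, Z3). vector [Z0 / Z1, Z3 / Z1]"
  by (auto simp: cp3_rel_def)
lift_definition quadric_aff2 :: "cp3 \<Rightarrow> complex^2" is
  "\<lambda>(Z0, Z1, Z2, Z3). vector [Z0 / Z2, Z3 / Z2]"
  by (auto simp: cp3_rel_def)
lift_definition quadric_aff3 :: "cp3 \<Rightarrow> complex^2" is
  "\<lambda>(Z0, Z1, Z2, Z3). vector [Z1 / Z3, Z2 / Z3]"
  by (auto simp: cp3_rel_def)

definition quadric_atlas :: "(cp3 set \<times> (cp3 \<Rightarrow> complex^2)) set" where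
  "quadric_atlas = {(quadric \<inter> Collect cp3_nz0, quadric_aff0), (quadric \<inter> Collect cp3_nz1, quadric_aff1),
                    (quadric \<inter> Collect cp3_nz2, quadric_aff2), (quadric \<inter> Collect cp3_nz3, quadric_aff3)}"

definition sev_holomorphic_on :: "(complex^'m \<Rightarrow> complex^'n) \<Rightarrow> (complex^'m) set \<Rightarrow> bool" where
  "sev_holomorphic_on G N \<longleftrightarrow>
     (\<forall>x\<in>N. \<exists>D. (G has_derivative D) (at x) \<and> Vector_Spaces.linear (*s) (*s) D)"

text \<open>Holomorphy of \<open>F\<close> on \<open>S\<close> between complex manifolds given by their atlases. The condition
  \<open>N \<subseteq> \<phi> ` (U \<inter> S)\<close> forces \<open>S\<close> to be open in the source manifold.\<close>

definition holomorphic_map ::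
  "('a set \<times> ('a \<Rightarrow> complex^'m)) set \<Rightarrow> ('b set \<times> ('b \<Rightarrow> complex^'n)) set \<Rightarrow> 'a set \<Rightarrow> ('a \<Rightarrow> 'b) \<Rightarrow> bool"
  where
  "holomorphic_map A B S F \<longleftrightarrow>
     (\<forall>p\<in>S. \<exists>(U, \<phi>)\<in>A. \<exists>(V, \<psi>)\<in>B. \<exists>N.
        p \<in> U \<and> F p \<in> V \<and> open N \<and> \<phi> p \<in> N \<and> N \<subseteq> \<phi> ` (U \<inter> S) \<and>
        (F \<circ> inv_into U \<phi>) ` N \<subseteq> V \<and>
        sev_holomorphic_on (\<psi> \<circ> F \<circ> inv_into U \<phi>) N)"

definition twistor_dom :: "quat set \<Rightarrow> cp3 set" where
  "twistor_dom \<Omega> = twistor_proj -` (hp1_embed ` (\<Omega> - \<real>)) \<inter> quadric_plus"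

definition hat :: "(complex \<Rightarrow> complex) \<Rightarrow> complex \<Rightarrow> complex" where
  "hat g z = cnj (g (cnj z))"

end

(* On the slice of i, regularity says that f = g + h j with g, h holomorphic. The identity theorem
   on each slice, started from a real point of the domain, gives the representation formula
     f(x + y I) = ((1 - I i) f(x + y i) + (1 + I i) f(x - y i)) / 2.
   A point of the quadric is [Z0, Z1, Z0 v, Z1 v]; with P = Z0 + Z1 j it lies over q = P^-1 v P, so
   q = x + y I for v = x + y i and I = P^-1 i P. Multiplying the formula by P turns it into
     P f(q) = Z0 f(v) + Z1 j f(cnj v) = (Z0 g(v) - Z1 ^h(v)) + (Z0 h(v) + Z1 ^g(v)) j,
   whose two components are the last homogeneous coordinates of the lift. The charts Z0 = 1 and
   Z1 = 1 suffice for its holomorphy, since Z0 and Z1 do not both vanish on the domain. *)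

theory Submission
  imports Defs "HOL-Complex_Analysis.Conformal_Mappings"
begin

section \<open>Slices\<close>

text \<open>Parametrizing every slice by the complex plane puts the restrictions of \<open>f\<close>
  to different slices on one planar domain, where they can be compared.\<close>

definition slice_point :: "quat \<Rightarrow> complex \<Rightarrow> quat" where
  "slice_point I z = of_real (Re z) + of_real (Im z) * I"

definition quat_i :: quat where
  "quat_i = Quat 0 1 0 0"

lemma quat_i_sel [simp]: "qre quat_i = 0" "qi quat_i = 1" "qj quat_i = 0" "qk quat_i = 0"
  by (simp_all add: quat_i_def)

lemma quat_of_real_sel [simp]:
  "qre (of_real r) = r" "qi (of_real r) = 0" "qj (of_real r) = 0" "qk (of_real r) = 0"
  by (simp_all add: of_real_def)

lemma imag_units_iff: "I \<in> imag_units \<longleftrightarrow> I * I = - 1"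
  by (simp add: imag_units_def power2_eq_square)

lemma quat_i_imag_units: "quat_i \<in> imag_units"
  by (simp add: imag_units_iff quat_eq_iff)

lemma quat_of_complex_eq_slice_point: "quat_of_complex z = slice_point quat_i z"
  by (simp add: slice_point_def quat_eq_iff)

lemma norm_quat_of_complex [simp]: "norm (quat_of_complex z) = norm z"
  by (simp add: norm_quat_def cmod_def)

lemma bounded_linear_quat_of_complex: "bounded_linear quat_of_complex"
  by (rule bounded_linear_intro[of _ 1]) (simp_all add: quat_eq_iff)

text \<open>For an imaginary unit \<open>I\<close>, left multiplication by \<open>I\<close> is
  skew-adjoint, so this is the Hermitian product of \<open>q\<close> and \<open>c\<close> for the
  complex structure given by \<open>I\<close>. With \<open>I = quat_i\<close>, taking
  \<open>c\<close> to be \<open>1\<close> or \<open>quat_j\<close> yields the components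
  \<open>z\<close> and \<open>w\<close> of \<open>q = z + w j\<close>.\<close>

definition slice_coord :: "quat \<Rightarrow> quat \<Rightarrow> quat \<Rightarrow> complex" where
  "slice_coord I c q = Complex (q \<bullet> c) (- ((I * q) \<bullet> c))"

lemma slice_coord_altdef: "slice_coord I c q = of_real (q \<bullet> c) - of_real ((I * q) \<bullet> c) * \<i>"
  by (simp add: slice_coord_def complex_eq_iff)

lemma bounded_linear_slice_coord: "bounded_linear (slice_coord I c)"
  unfolding slice_coord_altdef
  by (intro bounded_linear_sub bounded_linear_compose[OF bounded_linear_of_real]
      bounded_linear_mult_const bounded_linear_inner_left_comp bounded_linear_mult_right
      bounded_linear_ident)

lemma slice_coord_mult_left:
  assumes "I \<in> imag_units"
  shows "slice_coord I c (I * q) = \<i> * slice_coord I c q"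
proof -
  have "I * (I * q) = - q"
    using assms by (simp add: imag_units_iff mult.assoc[symmetric])
  then show ?thesis
    by (simp add: slice_coord_def complex_eq_iff)
qed

text \<open>The condition on \<open>E\<close> is the Cauchy--Riemann equation for the complex structure
  given by left multiplication with \<open>I\<close>, which \<^term>\<open>slice_coord I c\<close> intertwines with \<open>\<i>\<close>.\<close>

lemma slice_coord_holomorphic_on:
  assumes I: "I \<in> imag_units"
    and k: "\<And>z. z \<in> D \<Longrightarrow> \<exists>E. (k has_derivative E) (at z) \<and> E 1 + I * E \<i> = 0"
  shows "(\<lambda>z. slice_coord I c (k z)) holomorphic_on D"
proof (rule holomorphic_onI)
  fix z assume "z \<in> D"
  then obtain E where E: "(k has_derivative E) (at z)" and CR: "E 1 + I * E \<i> = 0"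
    using k by blast
  let ?L = "slice_coord I c"
  interpret E: bounded_linear E
    using E by (rule has_derivative_bounded_linear)
  interpret L: bounded_linear ?L
    by (rule bounded_linear_slice_coord)
  have "I * (E 1 + I * E \<i>) = I * E 1 - E \<i>"
    using I by (simp add: distrib_left mult.assoc[symmetric] imag_units_iff)
  then have Ei: "E \<i> = I * E 1"
    using CR by simp
  have "?L (E w) = ?L (E 1) * w" for w
  proof -
    have "w = Re w *\<^sub>R 1 + Im w *\<^sub>R \<i>"
      by (simp add: complex_eq_iff)
    then have "E w = Re w *\<^sub>R E 1 + Im w *\<^sub>R E \<i>"
      by (metis E.add E.scaleR)
    then show ?thesis
      by (simp add: Ei L.add L.scaleR slice_coord_mult_left[OF I] complex_eq_iff)
  qed
  then have eq: "(\<lambda>w. ?L (E w)) = (*) (?L (E 1))"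
    by blast
  have "((\<lambda>z. ?L (k z)) has_field_derivative ?L (E 1)) (at z)"
    using L.has_derivative[OF E] unfolding eq has_field_derivative_def .
  then show "(\<lambda>z. ?L (k z)) field_differentiable at z within D"
    using field_differentiable_at_within field_differentiable_def by blast
qed

text \<open>Composing with the map from \<open>z\<close> to \<open>(Re z, Im z)\<close> replaces the
  real plane by the complex one; \<open>E 1\<close> and \<open>E \<i>\<close> are then the two
  partial derivatives.\<close>

lemma slice_regular_on_has_derivative:
  assumes f: "slice_regular_on f \<Omega>" and I: "I \<in> imag_units" and z: "slice_point I z \<in> \<Omega>"
  obtains E where "((\<lambda>z. f (slice_point I z)) has_derivative E) (at z)" "E 1 + I * E \<i> = 0"
proof -
  obtain D where D: "((\<lambda>(s, t). f (of_real s + of_real t * I)) has_derivative D) (at (Re z, Im z))"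
    and CR: "(1/2) *\<^sub>R (D (1, 0) + I * D (0, 1)) = 0"
    using f I z unfolding slice_regular_on_def slice_point_def by blast
  have "((\<lambda>z. (Re z, Im z)) has_derivative (\<lambda>z. (Re z, Im z))) (at z)"
    by (intro derivative_intros)
  from has_derivative_compose[OF this D]
  show thesis
    using CR by (intro that[of "\<lambda>w. D (Re w, Im w)"]) (simp_all add: slice_point_def)
qed

section \<open>The representation formula\<close>

locale slice_domain =
  fixes \<Omega> :: "quat set"
  assumes symmetric_slice_domain: "symmetric_slice_domain \<Omega>"
begin

definition planar_slice :: "complex set" where
  "planar_slice = quat_of_complex -` \<Omega>"

text \<open>Axial symmetry moves a point between the slices of \<open>I\<close> and of i in both
  directions, so one planar set serves all slices.\<close>

lemma slice_point_mem_iff: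
  assumes "I \<in> imag_units"
  shows "slice_point I z \<in> \<Omega> \<longleftrightarrow> z \<in> planar_slice"
  using symmetric_slice_domain assms quat_i_imag_units
  unfolding symmetric_slice_domain_def planar_slice_def slice_point_def vimage_eq quat_of_complex_eq_slice_point
  by blast

lemma open_planar_slice: "open planar_slice"
proof -
  have "continuous_on UNIV quat_of_complex"
    using bounded_linear_quat_of_complex by (rule linear_continuous_on)
  then show ?thesis
    using symmetric_slice_domain unfolding planar_slice_def symmetric_slice_domain_def
    by (simp add: continuous_on_open_vimage)
qed

lemma connected_planar_slice: "connected planar_slice"
proof -
  \<comment> \<open>A continuous left inverse of \<open>quat_of_complex\<close>, which carries
    connectedness of the slice over to the plane.\<close>
  let ?p = "slice_coord quat_i 1"
  have p: "?p (quat_of_complex z) = z" for z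
    by (simp add: slice_coord_def inner_quat_def complex_eq_iff)
  have "slice quat_i = range quat_of_complex"
  proof (intro equalityI subsetI)
    fix q assume "q \<in> slice quat_i"
    then obtain x y where "q = of_real x + of_real y * quat_i"
      by (auto simp: slice_def)
    then have "q = quat_of_complex (Complex x y)"
      by (simp add: quat_eq_iff)
    then show "q \<in> range quat_of_complex"
      by blast
  next
    fix q assume "q \<in> range quat_of_complex"
    then show "q \<in> slice quat_i"
      unfolding slice_def quat_of_complex_eq_slice_point slice_point_def by blast
  qed
  moreover have "planar_slice = ?p ` (\<Omega> \<inter> range quat_of_complex)"
    unfolding planar_slice_def using p by (auto intro!: rev_image_eqI)
  ultimately have "planar_slice = ?p ` (\<Omega> \<inter> slice quat_i)"
    by simp
  moreover have "connected (\<Omega> \<inter> slice quat_i)"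
    using symmetric_slice_domain quat_i_imag_units by (simp add: symmetric_slice_domain_def)
  ultimately show ?thesis
    by (metis connected_continuous_image linear_continuous_on bounded_linear_slice_coord)
qed

text \<open>The slice of -i is the slice of i, parametrized by the conjugate.\<close>

lemma cnj_mem_planar_slice: "z \<in> planar_slice \<Longrightarrow> cnj z \<in> planar_slice"
proof -
  have "slice_point (- quat_i) z = slice_point quat_i (cnj z)"
    by (simp add: slice_point_def)
  moreover have "- quat_i \<in> imag_units"
    using quat_i_imag_units by (simp add: imag_units_iff)
  ultimately show "z \<in> planar_slice \<Longrightarrow> cnj z \<in> planar_slice"
    using slice_point_mem_iff quat_i_imag_units by metis
qed

text \<open>Identity theorem for the complex structure given by \<open>I\<close>: each coordinate of
  \<open>k\<close> is holomorphic and vanishes at the real points of the domain, which accumulate at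
  one of them.\<close>

lemma eq_0_on_planar_slice:
  assumes I: "I \<in> imag_units"
    and k: "\<And>z. z \<in> planar_slice \<Longrightarrow> \<exists>E. (k has_derivative E) (at z) \<and> E 1 + I * E \<i> = 0"
    and real: "\<And>t. k (of_real t) = 0" and "w \<in> planar_slice"
  shows "k w = 0"
proof -
  obtain r where "of_real r \<in> \<Omega>"
    using symmetric_slice_domain by (auto simp: symmetric_slice_domain_def Reals_def)
  moreover have "quat_of_complex (of_real r) = of_real r"
    by (simp add: quat_eq_iff)
  ultimately have r: "of_real r \<in> planar_slice"
    by (simp add: planar_slice_def)
  have lim: "of_real r islimpt (\<real> \<inter> planar_slice)"
  proof (unfold islimpt_approachable, intro allI impI)
    fix e :: real assume "e > 0"
    obtain d where "d > 0" "ball (of_real r) d \<subseteq> planar_slice"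
      using open_planar_slice r by (meson openE)
    moreover define t where "t = min d e / 2"
    moreover have "dist (of_real (r + t)) (complex_of_real r) = \<bar>t\<bar>"
      by (simp add: dist_norm)
    ultimately have "t > 0" "t < e" "dist (of_real (r + t)) (complex_of_real r) = t"
      "of_real (r + t) \<in> planar_slice"
      using \<open>e > 0\<close> by (auto simp: dist_commute subset_iff simp del: of_real_add)
    then show "\<exists>x\<in>\<real> \<inter> planar_slice. x \<noteq> complex_of_real r \<and> dist x (complex_of_real r) < e"
      by (intro bexI[of _ "of_real (r + t)"]) auto
  qed
  have "slice_coord I c (k w) = 0" for c
  proof (rule analytic_continuation[OF _ open_planar_slice connected_planar_slice _ r lim _ \<open>w \<in> planar_slice\<close>])
    show "(\<lambda>z. slice_coord I c (k z)) holomorphic_on planar_slice"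
      using I k by (rule slice_coord_holomorphic_on)
    show "slice_coord I c (k z) = 0" if "z \<in> \<real> \<inter> planar_slice" for z
      using that real linear_0[OF bounded_linear.linear[OF bounded_linear_slice_coord]]
      by (auto simp: Reals_def)
  qed auto
  \<comment> \<open>For \<open>c = k w\<close> the real part of the coordinate is the squared norm
    of \<open>k w\<close>.\<close>
  from this[of "k w"] show ?thesis
    by (simp add: slice_coord_def complex_eq_iff)
qed

text \<open>The difference of the two sides satisfies the Cauchy-Riemann equation for
  \<open>I\<close> and vanishes on the real axis, so it is zero by the identity theorem.\<close>

theorem representation_formula:
  assumes f: "slice_regular_on f \<Omega>" and I: "I \<in> imag_units" and z: "z \<in> planar_slice"
  shows "f (slice_point I z) = (1/2) *\<^sub>R ((1 - I * quat_i) * f (quat_of_complex z)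
    + (1 + I * quat_i) * f (quat_of_complex (cnj z)))"
proof -
  define k where "k z = f (slice_point I z) - (1/2) *\<^sub>R ((1 - I * quat_i) * f (slice_point quat_i z)
    + (1 + I * quat_i) * f (slice_point quat_i (cnj z)))" for z
  have "k z = 0"
  proof (rule eq_0_on_planar_slice[OF I _ _ z])
    fix z assume z: "z \<in> planar_slice"
    obtain A where A: "((\<lambda>z. f (slice_point I z)) has_derivative A) (at z)" "A 1 + I * A \<i> = 0"
      using z by (rule slice_regular_on_has_derivative[OF f I slice_point_mem_iff[OF I, THEN iffD2]])
    obtain B where B: "((\<lambda>z. f (slice_point quat_i z)) has_derivative B) (at z)"
      "B 1 + quat_i * B \<i> = 0"
      using z by (rule slice_regular_on_has_derivative[OF f quat_i_imag_units
            slice_point_mem_iff[OF quat_i_imag_units, THEN iffD2]])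
    obtain C where C: "((\<lambda>z. f (slice_point quat_i z)) has_derivative C) (at (cnj z))"
      "C 1 + quat_i * C \<i> = 0"
      using cnj_mem_planar_slice[OF z] by (rule slice_regular_on_has_derivative[OF f quat_i_imag_units
            slice_point_mem_iff[OF quat_i_imag_units, THEN iffD2]])
    have "(cnj has_derivative cnj) (at z)"
      by (intro derivative_intros)
    from has_derivative_compose[OF this C(1)]
    have C': "((\<lambda>z. f (slice_point quat_i (cnj z))) has_derivative (\<lambda>w. C (cnj w))) (at z)" .
    have Cm: "C (- \<i>) = - C \<i>"
      using C(1) by (intro linear_neg bounded_linear.linear has_derivative_bounded_linear)
    define b where "b = B \<i>"
    define c where "c = C \<i>"
    have "A 1 = - (I * A \<i>)" "B 1 = - (quat_i * b)" "C 1 = - (quat_i * c)"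
      using A(2) B(2) C(2) by (simp_all add: b_def c_def eq_neg_iff_add_eq_0)
    moreover have "I * (I * q) = - q" "quat_i * (quat_i * q) = - q" for q
      using I quat_i_imag_units by (simp_all add: imag_units_iff mult.assoc[symmetric])
    \<comment> \<open>The factor \<open>1 - I * quat_i\<close> turns left multiplication by i into
      that by \<open>I\<close>, and \<open>1 + I * quat_i\<close> turns it into that by
      \<open>- I\<close>; conjugating \<open>z\<close> in the second term compensates this
      sign.\<close>
    then have "(1 - I * quat_i) * (quat_i * b) = I * ((1 - I * quat_i) * b)"
      "(1 + I * quat_i) * (quat_i * c) = - (I * ((1 + I * quat_i) * c))"
      by (simp_all add: distrib_left distrib_right left_diff_distrib right_diff_distrib mult.assoc)
    ultimately have "(A 1 - (1/2) *\<^sub>R ((1 - I * quat_i) * B 1 + (1 + I * quat_i) * C 1))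
      + I * (A \<i> - (1/2) *\<^sub>R ((1 - I * quat_i) * b - (1 + I * quat_i) * c)) = 0"
      by (simp add: right_diff_distrib scaleR_right_diff_distrib scaleR_add_right)
    moreover have "(k has_derivative (\<lambda>w. A w - (1/2) *\<^sub>R ((1 - I * quat_i) * B w
        + (1 + I * quat_i) * C (cnj w)))) (at z)"
      unfolding k_def by (intro derivative_intros A(1) B(1) C')
    ultimately show "\<exists>E. (k has_derivative E) (at z) \<and> E 1 + I * E \<i> = 0"
      by (intro exI conjI) (assumption, simp add: Cm b_def c_def)
  next
    \<comment> \<open>At a real point all three values of \<open>f\<close> coincide, and the two
      coefficients sum to 2.\<close>
    show "k (of_real t) = 0" for t
      by (simp add: k_def slice_point_def algebra_simps flip: scaleR_2)
  qed
  then show ?thesis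
    by (simp add: k_def quat_of_complex_eq_slice_point)
qed

end

section \<open>Homogeneous coordinates\<close>

lemma cp3_rel_refl: "Z \<noteq> 0 \<Longrightarrow> cp3_rel Z Z"
  unfolding cp3_rel_def by (cases Z) (auto intro!: exI[of _ 1])

text \<open>In a partial quotient the chosen representative is related to itself, which here forces
  it to be nonzero.\<close>

lemma cp3_cases:
  obtains a b c d where "(a, b, c, d) \<noteq> 0" "p = cp3 a b c d"
proof -
  obtain a b c d where r: "rep_cp3 p = (a, b, c, d)"
    by (metis prod_cases4)
  have "cp3_rel (rep_cp3 p) (rep_cp3 p)"
    using Quotient3_rep_reflp[OF Quotient3_cp3] .
  moreover have "p = cp3 a b c d"
    using Quotient3_abs_rep[OF Quotient3_cp3, of p] by (simp add: cp3_def r)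
  moreover from calculation(1) have "(a, b, c, d) \<noteq> 0"
    unfolding r cp3_rel_def by blast
  ultimately show thesis
    using that by blast
qed

lemma cp3_scale:
  assumes "(a, b, c, d) \<noteq> 0" "t \<noteq> 0"
  shows "cp3 (t * a) (t * b) (t * c) (t * d) = cp3 a b c d"
  unfolding cp3_def
proof (rule sym, rule Quotient3_rel_abs[OF Quotient3_cp3])
  show "cp3_rel (a, b, c, d) (t * a, t * b, t * c, t * d)"
    using assms by (auto simp: cp3_rel_def)
qed

lemma rep_cp3_cp3:
  assumes "(a, b, c, d) \<noteq> 0"
  obtains t where "t \<noteq> 0" "rep_cp3 (cp3 a b c d) = (t * a, t * b, t * c, t * d)"
proof -
  have "cp3_rel (a, b, c, d) (rep_cp3 (cp3 a b c d))"
    unfolding cp3_def using Quotient3_cp3 cp3_rel_refl[OF assms] by (rule rep_abs_rsp)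
  then show thesis
    using that by (auto simp: cp3_rel_def)
qed

lemmas cp3_coords = on_quadric.abs_eq in_upper_part.abs_eq cp3_nz0.abs_eq cp3_nz1.abs_eq
  cp3_aff0.abs_eq cp3_aff1.abs_eq quadric_aff0.abs_eq quadric_aff1.abs_eq

lemmas cp3_coords_cp3 [simp] =
  cp3_coords[OF cp3_rel_refl, of "(_, _, _, _)", unfolded prod.case, folded cp3_def]

section \<open>Quaternions as pairs of complex numbers, and the quaternionic projective line\<close>

definition quat_pair :: "complex \<Rightarrow> complex \<Rightarrow> quat" where
  "quat_pair z w = quat_of_complex z + quat_of_complex w * quat_j"

lemma quat_pair_sel [simp]:
  "qre (quat_pair z w) = Re z" "qi (quat_pair z w) = Im z"
  "qj (quat_pair z w) = Re w" "qk (quat_pair z w) = Im w"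
  by (simp_all add: quat_pair_def)

lemma quat_pair_eq_0_iff [simp]: "quat_pair z w = 0 \<longleftrightarrow> z = 0 \<and> w = 0"
  by (simp add: quat_pair_def quat_of_complex_pair_eq_0)

lemma twistor_proj_cp3:
  "(a, b, c, d) \<noteq> 0 \<Longrightarrow> twistor_proj (cp3 a b c d) = hp1 (quat_pair a b) (quat_pair c d)"
  unfolding cp3_def hp1_def quat_pair_def by (simp add: twistor_proj.abs_eq cp3_rel_refl)

text \<open>Scaling \<open>(1, q)\<close> from the left by \<open>P\<close> gives
  \<open>(P, P * q)\<close>. This turns equalities of projective points into equations between
  quaternions.\<close>

lemma hp1_eq_embed_iff:
  assumes "P \<noteq> 0"
  shows "hp1 P R = hp1_embed q \<longleftrightarrow> R = P * q"
proof -
  have refl: "hp1_rel v v" if "v \<noteq> 0" for v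
    using that unfolding hp1_rel_def by (cases v) (auto intro!: exI[of _ 1])
  have "hp1 P R = hp1_embed q \<longleftrightarrow> hp1_rel (1, q) (P, R)"
    unfolding hp1_embed_def hp1_def
    using Quotient3_rel[OF Quotient3_hp1, of "(1, q)" "(P, R)"] refl assms
    by (auto simp: zero_prod_def)
  also have "\<dots> \<longleftrightarrow> R = P * q"
    using assms by (auto simp: hp1_rel_def zero_prod_def)
  finally show ?thesis .
qed

section \<open>The twistor lift\<close>

text \<open>The homogeneous form of the lift, with \<open>u = Z1 / Z0\<close>; it covers
  \<open>u = \<infinity>\<close> as the case \<open>Z0 = 0\<close>. On the quadric the two quotients
  for \<open>v\<close> agree wherever both denominators are nonzero.\<close>

definition twistor_lift :: "(complex \<Rightarrow> complex) \<Rightarrow> (complex \<Rightarrow> complex) \<Rightarrow> cp3 \<Rightarrow> cp3" where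
  "twistor_lift g h p = (case rep_cp3 p of (Z0, Z1, Z2, Z3) \<Rightarrow>
     let v = (if Z0 \<noteq> 0 then Z2 / Z0 else Z3 / Z1)
     in cp3 Z0 Z1 (Z0 * g v - Z1 * hat h v) (Z0 * h v + Z1 * hat g v))"

text \<open>The unknown factor \<open>t\<close> of the chosen representative cancels in
  \<open>v\<close> and multiplies all four coordinates of the image.\<close>

lemma twistor_lift_cp3:
  assumes "(a, b) \<noteq> 0"
  shows "twistor_lift g h (cp3 a b (a * v) (b * v))
    = cp3 a b (a * g v - b * hat h v) (a * h v + b * hat g v)"
proof -
  have nz: "(a, b, x, y) \<noteq> 0" for x y :: complex
    using assms by (auto simp: zero_prod_def)
  obtain t where t: "t \<noteq> 0" "rep_cp3 (cp3 a b (a * v) (b * v)) = (t * a, t * b, t * (a * v), t * (b * v))"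
    using rep_cp3_cp3[OF nz] by metis
  have v: "(if t * a \<noteq> 0 then t * (a * v) / (t * a) else t * (b * v) / (t * b)) = v"
    using assms t(1) by (auto simp: zero_prod_def)
  have "twistor_lift g h (cp3 a b (a * v) (b * v))
    = cp3 (t * a) (t * b) (t * (a * g v - b * hat h v)) (t * (a * h v + b * hat g v))"
    unfolding twistor_lift_def t(2) prod.case v Let_def by (simp add: algebra_simps)
  also have "\<dots> = cp3 a b (a * g v - b * hat h v) (a * h v + b * hat g v)"
    using nz t(1) by (rule cp3_scale)
  finally show ?thesis .
qed

section \<open>Points of the quadric over a given quaternion\<close>

lemma conj_eq_slice_point:
  assumes "P \<noteq> 0"
  shows "inverse P * quat_of_complex v * P = slice_point (inverse P * quat_i * P) v"
proof -
  have "quat_of_complex v = Re v *\<^sub>R 1 + Im v *\<^sub>R quat_i"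
    by (simp add: quat_eq_iff)
  then show ?thesis
    using assms by (simp add: slice_point_def distrib_left distrib_right of_real_def)
qed

lemma conj_imag_units:
  assumes "P \<noteq> 0"
  shows "inverse P * quat_i * P \<in> imag_units"
proof -
  have "inverse P * quat_i * P * (inverse P * quat_i * P) = inverse P * (quat_i * (P * inverse P) * quat_i) * P"
    by (simp only: mult.assoc)
  also have "\<dots> = - 1"
    using assms quat_i_imag_units by (simp add: imag_units_iff)
  finally show ?thesis
    by (simp add: imag_units_iff)
qed

lemma quat_pair_scale: "quat_pair (a * v) (b * v) = quat_of_complex v * quat_pair a b"
  by (simp add: quat_eq_iff algebra_simps)

text \<open>With \<open>P = a + b j\<close>, the last two coordinates combine to \<open>v P\<close>,
  so the point lies over \<open>q\<close> exactly when \<open>v P = P q\<close>.\<close>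

lemma twistor_proj_eq_embed_iff:
  assumes "(a, b) \<noteq> 0"
  shows "twistor_proj (cp3 a b (a * v) (b * v)) = hp1_embed q
    \<longleftrightarrow> q = slice_point (inverse (quat_pair a b) * quat_i * quat_pair a b) v"
proof -
  let ?P = "quat_pair a b"
  have P: "?P \<noteq> 0" and nz: "(a, b, a * v, b * v) \<noteq> 0"
    using assms by (auto simp: zero_prod_def)
  have "twistor_proj (cp3 a b (a * v) (b * v)) = hp1_embed q \<longleftrightarrow> quat_of_complex v * ?P = ?P * q"
    by (simp add: twistor_proj_cp3[OF nz] hp1_eq_embed_iff[OF P] quat_pair_scale)
  also have "\<dots> \<longleftrightarrow> q = inverse ?P * quat_of_complex v * ?P"
  proof
    assume "quat_of_complex v * ?P = ?P * q"
    then have "inverse ?P * quat_of_complex v * ?P = inverse ?P * ?P * q"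
      by (simp only: mult.assoc)
    then show "q = inverse ?P * quat_of_complex v * ?P"
      using P by simp
  next
    assume q: "q = inverse ?P * quat_of_complex v * ?P"
    have "?P * q = (?P * inverse ?P) * quat_of_complex v * ?P"
      unfolding q by (simp only: mult.assoc)
    then show "quat_of_complex v * ?P = ?P * q"
      using P by simp
  qed
  finally show ?thesis
    by (simp add: conj_eq_slice_point[OF P])
qed

text \<open>If \<open>y I\<close> equals a real number \<open>r\<close>, squaring gives
  \<open>- y * y = r * r\<close>, hence \<open>y = 0\<close>.\<close>

lemma slice_point_real_iff:
  assumes "I \<in> imag_units"
  shows "slice_point I v \<in> \<real> \<longleftrightarrow> Im v = 0"
proof
  assume "slice_point I v \<in> \<real>"
  then have "of_real (Im v) * I \<in> \<real>"
    unfolding slice_point_def by (metis Reals_diff Reals_of_real add_diff_cancel_left')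
  then obtain r where r: "of_real (Im v) * I = of_real r"
    by (rule Reals_cases)
  have "- of_real ((Im v)\<^sup>2) = of_real (Im v) * (of_real (Im v) * (I * I))"
    using assms by (simp add: imag_units_iff power2_eq_square)
  also have "\<dots> = (of_real (Im v) * I) * (of_real (Im v) * I)"
    by (simp add: of_real_def)
  also have "\<dots> = of_real (r\<^sup>2)"
    unfolding r by (simp add: power2_eq_square)
  finally have "- (Im v)\<^sup>2 = r\<^sup>2"
    by (metis of_real_eq_iff of_real_minus)
  then show "Im v = 0"
    by (smt (verit) zero_le_power2 power_eq_0_iff)
qed (simp add: slice_point_def)

text \<open>The equation of the quadric makes \<open>(Z2, Z3)\<close> a multiple of
  \<open>(Z0, Z1)\<close>, a pair that is nonzero on the upper part; the factor is
  \<open>v\<close>.\<close>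

lemma quadric_plus_cases:
  assumes "p \<in> quadric_plus"
  obtains a b v where "(a, b) \<noteq> 0" "p = cp3 a b (a * v) (b * v)"
proof -
  obtain a b c d where nz: "(a, b, c, d) \<noteq> 0" and p: "p = cp3 a b c d"
    by (rule cp3_cases)
  have q: "a * d = b * c" and "a \<noteq> 0 \<or> b \<noteq> 0"
    using assms nz by (auto simp: p quadric_plus_def quadric_def)
  then show thesis
  proof (elim disjE)
    assume "a \<noteq> 0"
    then have "a * (c / a) = c" "b * (c / a) = d"
      using q by (simp_all add: field_simps)
    with \<open>a \<noteq> 0\<close> show thesis
      by (intro that[of a b "c / a"]) (simp_all add: p zero_prod_def)
  next
    assume "b \<noteq> 0"
    then have "b * (d / b) = d" "a * (d / b) = c"
      using q by (simp_all add: field_simps)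
    with \<open>b \<noteq> 0\<close> show thesis
      by (intro that[of a b "d / b"]) (simp_all add: p zero_prod_def)
  qed
qed

context slice_domain
begin

text \<open>The unit \<open>I\<close> below the point varies with \<open>a\<close> and
  \<open>b\<close>, but by axial symmetry membership in \<open>\<Omega>\<close> depends on
  \<open>v\<close> only. The condition \<open>Im v > 0\<close> also keeps the image off the real
  axis.\<close>

lemma twistor_dom_iff:
  assumes "(a, b) \<noteq> 0"
  shows "cp3 a b (a * v) (b * v) \<in> twistor_dom \<Omega> \<longleftrightarrow> v \<in> planar_slice \<and> Im v > 0"
proof -
  let ?P = "quat_pair a b"
  define I where "I = inverse ?P * quat_i * ?P"
  have P: "?P \<noteq> 0" and nz: "(a, b, a * v, b * v) \<noteq> 0"
    using assms by (auto simp: zero_prod_def)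
  have I: "I \<in> imag_units"
    unfolding I_def using P by (rule conj_imag_units)
  have "cp3 a b (a * v) (b * v) \<in> quadric_plus \<longleftrightarrow> Im v > 0"
    using assms nz by (auto simp: quadric_plus_def quadric_def zero_prod_def)
  moreover have "twistor_proj (cp3 a b (a * v) (b * v)) \<in> hp1_embed ` (\<Omega> - \<real>)
      \<longleftrightarrow> slice_point I v \<in> \<Omega> - \<real>"
    unfolding image_iff twistor_proj_eq_embed_iff[OF assms] I_def by blast
  ultimately show ?thesis
    unfolding twistor_dom_def
    by (auto simp: slice_point_mem_iff[OF I] slice_point_real_iff[OF I])
qed

text \<open>With \<open>P = Z\<^sub>0 + Z\<^sub>1 j\<close> and \<open>I = P\<^sup>-\<^sup>1 i P\<close>, the coefficients of the representation formula
  satisfy \<open>P (1 - I i) / 2 = Z\<^sub>0\<close> and \<open>P (1 + I i) / 2 = Z\<^sub>1 j\<close>.\<close>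

lemma quat_pair_mult_regular:
  assumes f: "slice_regular_on f \<Omega>" and "(a, b) \<noteq> 0" and v: "v \<in> planar_slice"
  shows "quat_pair a b * f (slice_point (inverse (quat_pair a b) * quat_i * quat_pair a b) v)
    = quat_of_complex a * f (quat_of_complex v)
      + quat_of_complex b * quat_j * f (quat_of_complex (cnj v))"
proof -
  let ?P = "quat_pair a b"
  define I where "I = inverse ?P * quat_i * ?P"
  have P: "?P \<noteq> 0"
    using assms by (auto simp: zero_prod_def)
  have I: "I \<in> imag_units"
    unfolding I_def using P by (rule conj_imag_units)
  have "?P * I = (?P * inverse ?P) * quat_i * ?P"
    unfolding I_def by (simp only: mult.assoc)
  then have "?P * I = quat_i * ?P"
    using P by simp
  then have "?P * (1 - I * quat_i) = ?P - quat_i * ?P * quat_i"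
    "?P * (1 + I * quat_i) = ?P + quat_i * ?P * quat_i"
    by (simp_all add: right_diff_distrib distrib_left mult.assoc[symmetric])
  \<comment> \<open>Since i anticommutes with j, multiplying by i on both sides negates the
    component \<open>a\<close> and fixes \<open>b j\<close>.\<close>
  moreover have "?P - quat_i * ?P * quat_i = 2 *\<^sub>R quat_of_complex a"
    "?P + quat_i * ?P * quat_i = 2 *\<^sub>R (quat_of_complex b * quat_j)"
    by (simp_all add: quat_eq_iff)
  ultimately have PI: "?P * (1 - I * quat_i) = 2 *\<^sub>R quat_of_complex a"
    "?P * (1 + I * quat_i) = 2 *\<^sub>R (quat_of_complex b * quat_j)"
    by simp_all
  have "?P * f (slice_point I v) = (1/2) *\<^sub>R (?P * (1 - I * quat_i) * f (quat_of_complex v)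
      + ?P * (1 + I * quat_i) * f (quat_of_complex (cnj v)))"
  proof -
    have "x * ((1/2) *\<^sub>R (y * y' + z * z')) = (1/2) *\<^sub>R (x * y * y' + x * z * z')" for x y y' z z' :: quat
      by (simp add: distrib_left mult.assoc)
    then show ?thesis
      unfolding representation_formula[OF f I v] .
  qed
  then show ?thesis
    unfolding PI I_def[symmetric] by (simp add: scaleR_add_right)
qed

lemma twistor_proj_twistor_lift:
  assumes f: "slice_regular_on f \<Omega>"
    and gh: "\<And>z. f (quat_of_complex z) = quat_pair (g z) (h z)"
    and p: "p \<in> twistor_dom \<Omega>" and q: "twistor_proj p = hp1_embed q"
  shows "twistor_proj (twistor_lift g h p) = hp1_embed (f q)"
proof -
  have "p \<in> quadric_plus"
    using p by (simp add: twistor_dom_def)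
  then obtain a b v where ab: "(a, b) \<noteq> 0" and p_eq: "p = cp3 a b (a * v) (b * v)"
    by (rule quadric_plus_cases)
  have v: "v \<in> planar_slice"
    using p twistor_dom_iff[OF ab] by (simp add: p_eq)
  have P: "quat_pair a b \<noteq> 0" and nz: "(a, b, x, y) \<noteq> 0" for x y :: complex
    using ab by (auto simp: zero_prod_def)
  have "q = slice_point (inverse (quat_pair a b) * quat_i * quat_pair a b) v"
    using q twistor_proj_eq_embed_iff[OF ab] by (simp add: p_eq)
  then have "quat_pair a b * f q = quat_of_complex a * f (quat_of_complex v)
      + quat_of_complex b * quat_j * f (quat_of_complex (cnj v))"
    using quat_pair_mult_regular[OF f ab v] by simp
  \<comment> \<open>Moving j to the right past a complex number conjugates it; this produces
    \<open>hat g\<close> and \<open>hat h\<close>, and j squared gives the minus sign.\<close>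
  also have "\<dots> = quat_pair (a * g v - b * hat h v) (a * h v + b * hat g v)"
    unfolding gh by (simp add: quat_eq_iff hat_def algebra_simps)
  finally show ?thesis
    by (simp add: p_eq twistor_lift_cp3[OF ab] twistor_proj_cp3[OF nz] hp1_eq_embed_iff[OF P])
qed

end

section \<open>Holomorphy in charts\<close>

text \<open>A real derivative is already additive, so complex homogeneity is all that complex
  linearity adds. Scalar values allow rules for sums and products.\<close>

definition complex_diff_at :: "(complex^'m \<Rightarrow> complex) \<Rightarrow> complex^'m \<Rightarrow> bool" where
  "complex_diff_at f x \<longleftrightarrow> (\<exists>D. (f has_derivative D) (at x) \<and> (\<forall>c w. D (c *s w) = c * D w))"

lemma complex_diff_at_nth: "complex_diff_at (\<lambda>x. x $ i) x"
  unfolding complex_diff_at_def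
  by (intro exI[of _ "\<lambda>x. x $ i"]) (auto intro!: bounded_linear_imp_has_derivative bounded_linear_vec_nth)

lemma complex_diff_at_holomorphic:
  assumes "g holomorphic_on S" "open S" "x $ i \<in> S"
  shows "complex_diff_at (\<lambda>x. g (x $ i)) x"
proof -
  obtain g' where "(g has_field_derivative g') (at (x $ i))"
    using assms by (meson field_differentiable_def holomorphic_on_imp_differentiable_at)
  moreover have "((\<lambda>x. x $ i) has_derivative (\<lambda>x. x $ i)) (at x)"
    by (intro bounded_linear_imp_has_derivative bounded_linear_vec_nth)
  ultimately have "((\<lambda>x. g (x $ i)) has_derivative (\<lambda>w. g' * w $ i)) (at x)"
    unfolding has_field_derivative_def by (rule has_derivative_compose[rotated])
  then show ?thesis
    unfolding complex_diff_at_def by (intro exI[of _ "\<lambda>w. g' * w $ i"]) simp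
qed

lemma complex_diff_at_add:
  assumes "complex_diff_at f x" "complex_diff_at g x"
  shows "complex_diff_at (\<lambda>x. f x + g x) x"
proof -
  obtain D E where "(f has_derivative D) (at x)" "\<And>c w. D (c *s w) = c * D w"
    "(g has_derivative E) (at x)" "\<And>c w. E (c *s w) = c * E w"
    using assms unfolding complex_diff_at_def by blast
  then show ?thesis
    unfolding complex_diff_at_def
    by (intro exI[of _ "\<lambda>w. D w + E w"]) (auto intro: has_derivative_add simp: distrib_left)
qed

lemma complex_diff_at_mult:
  assumes "complex_diff_at f x" "complex_diff_at g x"
  shows "complex_diff_at (\<lambda>x. f x * g x) x"
proof -
  obtain D E where "(f has_derivative D) (at x)" "\<And>c w. D (c *s w) = c * D w"
    "(g has_derivative E) (at x)" "\<And>c w. E (c *s w) = c * E w"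
    using assms unfolding complex_diff_at_def by blast
  then show ?thesis
    unfolding complex_diff_at_def
    by (intro exI[of _ "\<lambda>w. f x * E w + D w * g x"]) (use has_derivative_mult in \<open>auto simp: distrib_left\<close>)
qed

lemma complex_diff_at_diff:
  assumes "complex_diff_at f x" "complex_diff_at g x"
  shows "complex_diff_at (\<lambda>x. f x - g x) x"
proof -
  obtain D E where "(f has_derivative D) (at x)" "\<And>c w. D (c *s w) = c * D w"
    "(g has_derivative E) (at x)" "\<And>c w. E (c *s w) = c * E w"
    using assms unfolding complex_diff_at_def by blast
  then show ?thesis
    unfolding complex_diff_at_def
    by (intro exI[of _ "\<lambda>w. D w - E w"]) (auto intro: has_derivative_diff simp: right_diff_distrib)
qed

section \<open>From components to vector-valued maps and chart expressions\<close>

lemma has_derivative_vecI: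
  fixes G :: "'a::real_normed_vector \<Rightarrow> 'b::real_normed_vector^'n"
  assumes "\<And>i. ((\<lambda>x. G x $ i) has_derivative (\<lambda>w. G' w $ i)) (at x)"
  shows "(G has_derivative G') (at x)"
  unfolding has_derivative_def
proof (intro conjI vec_tendstoI)
  have lin: "bounded_linear (\<lambda>w. G' w $ i)" for i
    using assms by (rule has_derivative_bounded_linear)
  have "\<exists>K. \<forall>w. norm (G' w $ i) \<le> norm w * K" for i
    using bounded_linear.bounded[OF lin] .
  then obtain K where K: "\<And>i w. norm (G' w $ i) \<le> norm w * K i"
    by metis
  show "bounded_linear G'"
  proof (rule bounded_linear_intro)
    show "G' (v + w) = G' v + G' w" for v w
      using linear_add[OF bounded_linear.linear[OF lin]] by (simp add: vec_eq_iff)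
    show "G' (r *\<^sub>R w) = r *\<^sub>R G' w" for r w
      using linear_scale[OF bounded_linear.linear[OF lin]] by (simp add: vec_eq_iff)
    show "norm (G' w) \<le> norm w * (\<Sum>i\<in>UNIV. K i)" for w
      unfolding norm_vec_def
      by (rule order_trans[OF L2_set_le_sum]) (auto simp: sum_distrib_left intro: sum_mono K)
  qed
qed (use assms in \<open>simp add: has_derivative_def\<close>)

text \<open>\<open>H\<close> is meant to be a chart expression and \<open>G\<close> an explicit
  formula for it on \<open>N\<close>; openness of \<open>N\<close> lets \<open>H\<close> inherit the
  derivative of \<open>G\<close>.\<close>

lemma sev_holomorphic_onI:
  fixes G :: "complex^'m \<Rightarrow> complex^'n"
  assumes "open N" and eq: "\<And>x. x \<in> N \<Longrightarrow> H x = G x"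
    and G: "\<And>x i. x \<in> N \<Longrightarrow> complex_diff_at (\<lambda>x. G x $ i) x"
  shows "sev_holomorphic_on H N"
  unfolding sev_holomorphic_on_def
proof
  fix x assume x: "x \<in> N"
  obtain D where D: "\<And>i. ((\<lambda>x. G x $ i) has_derivative D i) (at x)"
    and lin: "\<And>i c w. D i (c *s w) = c * D i w"
    using G[OF x] unfolding complex_diff_at_def by metis
  let ?D = "\<lambda>w. \<chi> i. D i w"
  have "(G has_derivative ?D) (at x)"
    using D by (intro has_derivative_vecI) simp
  then have H: "(H has_derivative ?D) (at x)"
    by (rule has_derivative_transform_within_open[OF _ \<open>open N\<close> x]) (simp add: eq)
  moreover have "Vector_Spaces.linear (*s) (*s) ?D"
    using linear_add[OF has_derivative_linear[OF H]] lin
    by (auto simp: Vector_Spaces.linear_iff vec.vector_space_axioms vec_eq_iff)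
  ultimately show "\<exists>D. (H has_derivative D) (at x) \<and> Vector_Spaces.linear (*s) (*s) D"
    by blast
qed

text \<open>The map \<open>\<sigma>\<close> is an explicit inverse of the chart on \<open>N\<close>;
  by injectivity it agrees there with \<open>inv_into U \<phi>\<close>.\<close>

lemma holomorphic_in_charts:
  assumes "(U, \<phi>) \<in> A" "(V, \<psi>) \<in> B" and p: "p \<in> U" "\<phi> p \<in> N" and N: "open N" and inj: "inj_on \<phi> U"
    and \<sigma>: "\<And>x. x \<in> N \<Longrightarrow> \<sigma> x \<in> U \<inter> S" "\<And>x. x \<in> N \<Longrightarrow> \<phi> (\<sigma> x) = x"
    and F: "\<And>x. x \<in> N \<Longrightarrow> F (\<sigma> x) \<in> V" "\<And>x. x \<in> N \<Longrightarrow> \<psi> (F (\<sigma> x)) = G x"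
    and G: "\<And>x i. x \<in> N \<Longrightarrow> complex_diff_at (\<lambda>x. G x $ i) x"
  shows "\<exists>(U, \<phi>)\<in>A. \<exists>(V, \<psi>)\<in>B. \<exists>N. p \<in> U \<and> F p \<in> V \<and> open N \<and> \<phi> p \<in> N \<and>
    N \<subseteq> \<phi> ` (U \<inter> S) \<and> (F \<circ> inv_into U \<phi>) ` N \<subseteq> V \<and>
    sev_holomorphic_on (\<psi> \<circ> F \<circ> inv_into U \<phi>) N"
proof -
  have inv: "inv_into U \<phi> x = \<sigma> x" if "x \<in> N" for x
    using inj \<sigma>[OF that] by (intro inv_into_f_eq) auto
  have "F p \<in> V"
    using F(1)[OF p(2)] inv[OF p(2)] inj p(1) by simp
  moreover have "N \<subseteq> \<phi> ` (U \<inter> S)"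
    using \<sigma> by (metis image_eqI subsetI)
  moreover have "(F \<circ> inv_into U \<phi>) ` N \<subseteq> V"
    using inv F(1) by auto
  moreover have "sev_holomorphic_on (\<psi> \<circ> F \<circ> inv_into U \<phi>) N"
    using N by (rule sev_holomorphic_onI[where G = G]) (simp_all add: inv F G)
  ultimately show ?thesis
    using assms(1,2) p N
    by (intro bexI[of _ "(U, \<phi>)"] bexI[of _ "(V, \<psi>)"]) auto
qed

text \<open>The factors \<open>1\<close> keep both normal forms instances of \<open>cp3 a b (a * v) (b * v)\<close>, the shape
  in which the lift and its domain are described above.\<close>

lemma quadric_aff0_inverse:
  assumes "p \<in> quadric \<inter> Collect cp3_nz0"
  shows "p = cp3 1 (quadric_aff0 p $ 1) (1 * quadric_aff0 p $ 2) (quadric_aff0 p $ 1 * quadric_aff0 p $ 2)"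
proof -
  obtain a b c d where nz: "(a, b, c, d) \<noteq> 0" and p: "p = cp3 a b c d"
    by (rule cp3_cases)
  have a: "a \<noteq> 0" and q: "a * d = b * c"
    using assms nz by (auto simp: p quadric_def)
  have "p = cp3 (1 / a * a) (1 / a * b) (1 / a * c) (1 / a * d)"
    unfolding p by (rule cp3_scale[symmetric]) (use nz a in auto)
  also have "1 / a * d = b / a * (c / a)"
    using a q by (simp add: field_simps)
  finally have "p = cp3 1 (b / a) (c / a) (b / a * (c / a))"
    using a by simp
  moreover have "quadric_aff0 p $ 1 = b / a" "quadric_aff0 p $ 2 = c / a"
    using nz by (simp_all add: p)
  ultimately show ?thesis
    by (simp only: mult_1)
qed

lemma quadric_aff1_inverse:
  assumes "p \<in> quadric \<inter> Collect cp3_nz1"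
  shows "p = cp3 (quadric_aff1 p $ 1) 1 (quadric_aff1 p $ 1 * quadric_aff1 p $ 2) (1 * quadric_aff1 p $ 2)"
proof -
  obtain a b c d where nz: "(a, b, c, d) \<noteq> 0" and p: "p = cp3 a b c d"
    by (rule cp3_cases)
  have b: "b \<noteq> 0" and q: "a * d = b * c"
    using assms nz by (auto simp: p quadric_def)
  have "p = cp3 (1 / b * a) (1 / b * b) (1 / b * c) (1 / b * d)"
    unfolding p by (rule cp3_scale[symmetric]) (use nz b in auto)
  also have "1 / b * c = a / b * (d / b)"
    using b q by (simp add: field_simps)
  finally have "p = cp3 (a / b) 1 (a / b * (d / b)) (d / b)"
    using b by simp
  moreover have "quadric_aff1 p $ 1 = a / b" "quadric_aff1 p $ 2 = d / b"
    using nz by (simp_all add: p)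
  ultimately show ?thesis
    by (simp only: mult_1)
qed

context slice_domain
begin

text \<open>The planar domain is invariant under conjugation, and conjugating both argument and
  value preserves holomorphy.\<close>

lemma hat_holomorphic_on:
  assumes "g holomorphic_on planar_slice"
  shows "hat g holomorphic_on planar_slice"
proof -
  have "cnj ` planar_slice = planar_slice"
    using cnj_mem_planar_slice
    by (metis (no_types, lifting) complex_cnj_cnj image_iff image_subsetI subsetI subset_antisym)
  then have "(cnj \<circ> g \<circ> cnj) holomorphic_on planar_slice"
    using assms open_planar_slice by (intro holomorphic_on_compose_cnj_cnj) simp_all
  moreover have "hat g = cnj \<circ> g \<circ> cnj"
    by (simp add: fun_eq_iff hat_def)
  ultimately show ?thesis
    by simp
qed

lemma twistor_lift_holomorphic_map:
  assumes g: "g holomorphic_on planar_slice" and h: "h holomorphic_on planar_slice"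
  shows "holomorphic_map quadric_atlas cp3_atlas (twistor_dom \<Omega>) (twistor_lift g h)"
  unfolding holomorphic_map_def
proof
  \<comment> \<open>In both charts the second coordinate is \<open>v\<close>, the only quantity that
    the domain restricts, so the same \<open>N\<close> serves for both.\<close>
  define N :: "(complex^2) set" where "N = {x. x $ 2 \<in> planar_slice \<and> Im (x $ 2) > 0}"
  have "open ((\<lambda>x::complex^2. x $ 2) -` (planar_slice \<inter> {z. Im z > 0}))"
    by (intro open_vimage open_Int open_planar_slice open_halfspace_Im_gt continuous_intros)
  then have N: "open N"
    by (simp add: N_def vimage_def)
  define \<sigma>0 \<sigma>1 :: "complex^2 \<Rightarrow> cp3" where "\<sigma>0 x = cp3 1 (x $ 1) (1 * x $ 2) (x $ 1 * x $ 2)"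
    and "\<sigma>1 x = cp3 (x $ 1) 1 (x $ 1 * x $ 2) (1 * x $ 2)" for x
  \<comment> \<open>The lift keeps \<open>Z0\<close> and \<open>Z1\<close>, so the target chart can
    have the same index as the source chart; these are the resulting affine expressions.\<close>
  define G0 G1 :: "complex^2 \<Rightarrow> complex^3" where
    "G0 x = vector [x $ 1, g (x $ 2) - x $ 1 * hat h (x $ 2), h (x $ 2) + x $ 1 * hat g (x $ 2)]"
    and "G1 x = vector [x $ 1, x $ 1 * g (x $ 2) - hat h (x $ 2), x $ 1 * h (x $ 2) + hat g (x $ 2)]" for x
  have diff: "complex_diff_at (\<lambda>x. k (x $ 2)) x" if "k holomorphic_on planar_slice" "x \<in> N" for k x
    using that open_planar_slice by (intro complex_diff_at_holomorphic) (auto simp: N_def)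
  note diffs = diff[OF g] diff[OF h] diff[OF hat_holomorphic_on[OF g]] diff[OF hat_holomorphic_on[OF h]]
  have G: "complex_diff_at (\<lambda>x. G0 x $ i) x" "complex_diff_at (\<lambda>x. G1 x $ i) x" if "x \<in> N" for x i
    using exhaust_3[of i]
    by (elim disjE; simp add: G0_def G1_def;
        intro complex_diff_at_add complex_diff_at_mult complex_diff_at_diff complex_diff_at_nth diffs that)+
  let ?F = "twistor_lift g h"
  let ?U0 = "quadric \<inter> Collect cp3_nz0" and ?U1 = "quadric \<inter> Collect cp3_nz1"
  have inj0: "inj_on quadric_aff0 ?U0"
    using quadric_aff0_inverse by (intro inj_onI) metis
  have inj1: "inj_on quadric_aff1 ?U1"
    using quadric_aff1_inverse by (intro inj_onI) metis
  have dom0: "\<sigma>0 x \<in> twistor_dom \<Omega> \<longleftrightarrow> x \<in> N" and dom1: "\<sigma>1 x \<in> twistor_dom \<Omega> \<longleftrightarrow> x \<in> N" for x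
    by (simp_all only: \<sigma>0_def \<sigma>1_def twistor_dom_iff N_def mem_Collect_eq zero_prod_def prod.inject
        one_neq_zero simp_thms)
  have F: "?F (\<sigma>0 x) = cp3 1 (x $ 1) (G0 x $ 2) (G0 x $ 3)" "?F (\<sigma>1 x) = cp3 (x $ 1) 1 (G1 x $ 2) (G1 x $ 3)" for x
    unfolding \<sigma>0_def \<sigma>1_def by (subst twistor_lift_cp3; simp add: G0_def G1_def zero_prod_def)+
  have chart0: "\<sigma>0 x \<in> ?U0" "quadric_aff0 (\<sigma>0 x) = x" "cp3_nz0 (?F (\<sigma>0 x))" "cp3_aff0 (?F (\<sigma>0 x)) = G0 x"
    and chart1: "\<sigma>1 x \<in> ?U1" "quadric_aff1 (\<sigma>1 x) = x" "cp3_nz1 (?F (\<sigma>1 x))" "cp3_aff1 (?F (\<sigma>1 x)) = G1 x" for x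
    unfolding F by (simp_all add: \<sigma>0_def \<sigma>1_def quadric_def zero_prod_def vec_eq_iff forall_2 forall_3 G0_def G1_def)
  fix p assume p: "p \<in> twistor_dom \<Omega>"
  then have "p \<in> quadric_plus"
    by (simp add: twistor_dom_def)
  then have "p \<in> ?U0 \<or> p \<in> ?U1"
    by (cases p rule: cp3_cases) (auto simp: quadric_plus_def quadric_def)
  then show "\<exists>(U, \<phi>)\<in>quadric_atlas. \<exists>(V, \<psi>)\<in>cp3_atlas. \<exists>N. p \<in> U \<and> ?F p \<in> V \<and> open N \<and> \<phi> p \<in> N \<and>
      N \<subseteq> \<phi> ` (U \<inter> twistor_dom \<Omega>) \<and> (?F \<circ> inv_into U \<phi>) ` N \<subseteq> V \<and>
      sev_holomorphic_on (\<psi> \<circ> ?F \<circ> inv_into U \<phi>) N"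
  proof
    assume p0: "p \<in> ?U0"
    then have "p = \<sigma>0 (quadric_aff0 p)"
      unfolding \<sigma>0_def by (rule quadric_aff0_inverse)
    then have "quadric_aff0 p \<in> N"
      using p dom0 by metis
    then show ?thesis
      by (intro holomorphic_in_charts[OF _ _ p0 _ N inj0,
            where V = "Collect cp3_nz0" and \<psi> = cp3_aff0 and \<sigma> = \<sigma>0 and G = G0])
        (auto simp: quadric_atlas_def cp3_atlas_def dom0 chart0[unfolded Int_iff mem_Collect_eq] G)
  next
    assume p1: "p \<in> ?U1"
    then have "p = \<sigma>1 (quadric_aff1 p)"
      unfolding \<sigma>1_def by (rule quadric_aff1_inverse)
    then have "quadric_aff1 p \<in> N"
      using p dom1 by metis
    then show ?thesis
      by (intro holomorphic_in_charts[OF _ _ p1 _ N inj1,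
            where V = "Collect cp3_nz1" and \<psi> = cp3_aff1 and \<sigma> = \<sigma>1 and G = G1])
        (auto simp: quadric_atlas_def cp3_atlas_def dom1 chart1[unfolded Int_iff mem_Collect_eq] G)
  qed
qed

end

theorem theorem5p3:
  fixes \<Omega> :: "quat set" and f :: "quat \<Rightarrow> quat"
  assumes "symmetric_slice_domain \<Omega>" and "slice_regular_on f \<Omega>"
  shows "\<exists>(F :: cp3 \<Rightarrow> cp3) (g :: complex \<Rightarrow> complex) (h :: complex \<Rightarrow> complex).
    g holomorphic_on (quat_of_complex -` \<Omega>) \<and>
    h holomorphic_on (quat_of_complex -` \<Omega>) \<and>
    holomorphic_map quadric_atlas cp3_atlas (twistor_dom \<Omega>) F \<and>
    (\<forall>u v. cp3 1 u v (u * v) \<in> twistor_dom \<Omega> \<longrightarrow>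
       F (cp3 1 u v (u * v)) = cp3 1 u (g v - u * hat h v) (h v + u * hat g v)) \<and>
    (\<forall>v. cp3 0 1 0 v \<in> twistor_dom \<Omega> \<longrightarrow>
       F (cp3 0 1 0 v) = cp3 0 1 (- hat h v) (hat g v)) \<and>
    (\<forall>p\<in>twistor_dom \<Omega>. \<forall>q\<in>\<Omega>.
       twistor_proj p = hp1_embed q \<longrightarrow> twistor_proj (F p) = hp1_embed (f q))"
proof -
  interpret slice_domain \<Omega>
    using assms(1) by unfold_locales
  \<comment> \<open>The components of \<open>f = g + h j\<close> on the slice of i.\<close>
  define g h where "g z = slice_coord quat_i 1 (f (slice_point quat_i z))"
    and "h z = slice_coord quat_i quat_j (f (slice_point quat_i z))" for z
  have "\<exists>E. ((\<lambda>z. f (slice_point quat_i z)) has_derivative E) (at z) \<and> E 1 + quat_i * E \<i> = 0"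
    if "z \<in> planar_slice" for z
    using that slice_point_mem_iff[OF quat_i_imag_units]
    by (blast elim: slice_regular_on_has_derivative[OF assms(2) quat_i_imag_units])
  then have gh: "g holomorphic_on planar_slice" "h holomorphic_on planar_slice"
    unfolding g_def h_def by (auto intro!: slice_coord_holomorphic_on quat_i_imag_units)
  have "f (quat_of_complex z) = quat_pair (g z) (h z)" for z
    by (simp add: g_def h_def slice_coord_def quat_of_complex_eq_slice_point quat_eq_iff inner_quat_def)
  then have "twistor_proj (twistor_lift g h p) = hp1_embed (f q)"
    if "p \<in> twistor_dom \<Omega>" "twistor_proj p = hp1_embed q" for p q
    using that by (intro twistor_proj_twistor_lift assms(2)) auto
  moreover have "twistor_lift g h (cp3 1 u v (u * v)) = cp3 1 u (g v - u * hat h v) (h v + u * hat g v)" for u v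
    using twistor_lift_cp3[of 1 u g h v] by (simp add: zero_prod_def)
  moreover have "twistor_lift g h (cp3 0 1 0 v) = cp3 0 1 (- hat h v) (hat g v)" for v
    using twistor_lift_cp3[of 0 1 g h v] by (simp add: zero_prod_def)
  ultimately show ?thesis
    using gh twistor_lift_holomorphic_map[OF gh] unfolding planar_slice_def
    by (intro exI[of _ "twistor_lift g h"] exI[of _ g] exI[of _ h]) auto
qed

end
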